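(* Let $(X,\mathcal{B},\mu,T)$ be a measure-preserving dynamical system ($\mu$ a probability measure) and let $\mathcal{C}$ be a collection of measurable subsets of $X$. Suppose that $\mu$ is $\Sigma$-mixing with respect to $(T,\mathcal{C})$ and let $\{E_n\}_{n\in\mathbb{N}}$ be a sequence of subsets in $\mathcal{C}$. Then $$\mu\big(W(T,\{E_n\})\big)=\begin{cases}0 & \text{if } \sum_{n=1}^\infty\mu(E_n)<\infty,\\ 1 & \text{if } \sum_{n=1}^\infty\mu(E_n)=\infty.\end{cases}$$
   Context: $W(T,\{E_n\}):=\limsup_{n\to\infty}T^{-n}(E_n)=\{x\in X: T^n(x)\in E_n \text{ for infinitely many } n\in\mathbb{N}\}$. $\Sigma$-mixing: for $n\in\mathbb{N}$ let $$\phi(n):=\sup\left\{\left|\frac{\mu(E\cap T^{-n}F)}{\mu(F)}-\mu(E)\right| : E\in\mathcal{C},\ F\in\mathcal{C}\right\}$$ (the supremum being over $F$ with $\mu(F)>0$). The measure $\mu$ is $\Sigma$-mixing (summable-mixing) with respect to $(T,\mathcal{C})$ if $\sum_{n=1}^\infty\phi(n)$ converges. *)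

theory Defs
  imports "HOL-Probability.Probability"
begin

definition measure_preserving_map :: "'a measure \<Rightarrow> ('a \<Rightarrow> 'a) \<Rightarrow> bool" where
  "measure_preserving_map M T \<longleftrightarrow>
     T \<in> measurable M M \<and> (\<forall>A\<in>sets M. emeasure M (T -` A \<inter> space M) = emeasure M A)"

definition hitting_limsup :: "'a measure \<Rightarrow> ('a \<Rightarrow> 'a) \<Rightarrow> (nat \<Rightarrow> 'a set) \<Rightarrow> 'a set" where
  "hitting_limsup M T E = {x \<in> space M. \<exists>\<^sub>\<infinity>n. (T ^^ n) x \<in> E n}"

text \<open>The supremum is taken in \<^typ>\<open>ennreal\<close> so that it is always well defined; in particular it
  is 0 when \<open>\<C>\<close> contains no set of positive measure.\<close>

definition mixing_coeff :: "'a measure \<Rightarrow> ('a \<Rightarrow> 'a) \<Rightarrow> 'a set set \<Rightarrow> nat \<Rightarrow> ennreal" where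
  "mixing_coeff M T \<C> n =
     Sup {ennreal \<bar>measure M (E \<inter> ((T ^^ n) -` F \<inter> space M)) / measure M F - measure M E\<bar> | E F.
            E \<in> \<C> \<and> F \<in> \<C> \<and> measure M F > 0}"

definition summable_mixing :: "'a measure \<Rightarrow> ('a \<Rightarrow> 'a) \<Rightarrow> 'a set set \<Rightarrow> bool" where
  "summable_mixing M T \<C> \<longleftrightarrow> (\<Sum>n. mixing_coeff M T \<C> (Suc n)) < \<infinity>"

text \<open>Since \<^const>\<open>emeasure\<close> is 0 on non-measurable sets, we record that the limsup set is measurable.
  The set \<open>E 0\<close> is irrelevant, as sequences are indexed by the positive integers.\<close>

lemma sets_hitting_limsup:
  assumes T: "T \<in> measurable M M" and E: "\<And>n. n \<ge> 1 \<Longrightarrow> E n \<in> sets M"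
  shows "hitting_limsup M T E \<in> sets M"
proof -
  have Tn: "(T ^^ n) \<in> measurable M M" for n
    by (induction n) (auto simp: id_def intro: measurable_compose[OF _ T])
  have "hitting_limsup M T E = (\<Inter>m. \<Union>n\<in>{Suc m..}. (T ^^ n) -` E n \<inter> space M)"
    by (auto simp: hitting_limsup_def INFM_nat Suc_le_eq Bex_def)
  also have "\<dots> \<in> sets M"
  proof (intro sets.countable_INT, safe)
    fix m :: nat
    have "(T ^^ n) -` E n \<inter> space M \<in> sets M" if "n \<in> {Suc m..}" for n
      using that by (intro measurable_sets[OF Tn E]) auto
    then show "(\<Union>n\<in>{Suc m..}. (T ^^ n) -` E n \<inter> space M) \<in> sets M"
      by (intro sets.countable_UN') auto
  qed
  finally show ?thesis .
qed

end

(* The convergence case is the first Borel-Cantelli lemma. In the divergence case let S_N count the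
   n \<le> N with T^n x in E_n. Invariance and mixing give, for m < n,
     mu(T^-m E_m \<inter> T^-n E_n) \<le> mu(E_m) mu(E_n) + phi(n - m) mu(E_n),
   and summing over m and n bounds the variance of S_N by a constant times its expectation, which
   tends to infinity. By Chebyshev's inequality S_N is then almost surely unbounded. *)
theory Submission
  imports Defs
begin

text \<open>The left side of \<open>pairs\<close> is the second moment of the number of events hit
  before time N, so \<open>pairs\<close> bounds the variance of this count by C times its mean.
  Divergence of the mean then lets Chebyshev's inequality rule out bounded counts.\<close>

lemma (in prob_space) borel_cantelli_variance:
  fixes A :: "nat \<Rightarrow> 'a set" and C :: real
  assumes A [measurable]: "\<And>n. A n \<in> events"
    and div: "\<not> summable (\<lambda>n. prob (A n))"
    and pairs: "\<And>N. (\<Sum>m<N. \<Sum>n<N. prob (A m \<inter> A n)) \<le>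
                  (\<Sum>n<N. prob (A n))\<^sup>2 + C * (\<Sum>n<N. prob (A n))"
  shows "AE x in M. \<exists>\<^sub>\<infinity>n. x \<in> A n"
proof -
  define S where "S N x = (\<Sum>n<N. indicator (A n) x :: real)" for N x
  define p where "p N = (\<Sum>n<N. prob (A n))" for N
  have [measurable]: "S N \<in> borel_measurable M" for N
    unfolding S_def by measurable
  have int_ind: "integrable M (indicator B :: 'a \<Rightarrow> real)" if "B \<in> events" for B
    using that by (simp add: emeasure_eq_measure)
  have ES: "expectation (S N) = p N" for N
    unfolding S_def p_def by (subst Bochner_Integration.integral_sum) (auto simp: int_ind)
  have sq: "(\<lambda>x. (S N x)\<^sup>2) = (\<lambda>x. \<Sum>m<N. \<Sum>n<N. indicator (A m \<inter> A n) x)" for N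
    by (simp add: S_def power2_eq_square sum_product indicator_inter_arith)
  have intS: "integrable M (S N)" for N
    unfolding S_def by (intro Bochner_Integration.integrable_sum int_ind A)
  have int2: "integrable M (\<lambda>x. (S N x)\<^sup>2)" for N
    unfolding sq by (intro Bochner_Integration.integrable_sum int_ind sets.Int A)
  have "expectation (\<lambda>x. (S N x)\<^sup>2) = (\<Sum>m<N. \<Sum>n<N. prob (A m \<inter> A n))" for N
    unfolding sq
    by (subst Bochner_Integration.integral_sum,
        (intro Bochner_Integration.integrable_sum int_ind sets.Int A; fail),
        subst Bochner_Integration.integral_sum) (auto simp: int_ind)
  moreover have "variance (S N) = expectation (\<lambda>x. (S N x)\<^sup>2) - (p N)\<^sup>2" for N
    using variance_eq[OF intS int2] by (simp only: ES)
  ultimately have var: "variance (S N) \<le> C * p N" for N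
    using pairs[of N] by (simp add: p_def)
  \<comment> \<open>The partial sums increase, so if they do not tend to infinity they are bounded,
    and nonnegative terms with bounded partial sums are summable.\<close>
  have p_top: "filterlim p at_top sequentially"
  proof (rule ccontr)
    assume "\<not> filterlim p at_top sequentially"
    then obtain Z where Z: "\<exists>\<^sub>F N in sequentially. \<not> Z \<le> p N"
      unfolding filterlim_at_top not_eventually[symmetric] by auto
    have "p N \<le> Z" for N
    proof -
      obtain N' where "N' \<ge> N" "p N' < Z"
        using Z unfolding frequently_sequentially by (auto simp: not_le)
      moreover have "p N \<le> p N'"
        unfolding p_def using \<open>N' \<ge> N\<close> by (intro sum_mono2) auto
      ultimately show ?thesis by simp
    qed
    then have "summable (\<lambda>n. prob (A n))"
      by (intro summableI_nonneg_bounded[of _ Z]) (auto simp: p_def)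
    with div show False by simp
  qed
  have null: "AE x in M. \<exists>N. S N x > real k" for k
  proof -
    define B where "B = {x \<in> space M. \<forall>N. S N x \<le> real k}"
    have [measurable]: "B \<in> events"
      unfolding B_def by measurable
    \<comment> \<open>The threshold makes \<open>p N\<close> positive and k at most
      \<open>p N / 2\<close>. On \<open>B\<close> the count therefore lies at least
      \<open>p N / 2\<close> below its mean, which is the deviation given to Chebyshev.\<close>
    have bound: "prob B \<le> 4 * C / p N" if N: "p N \<ge> 2 * real k + 1" for N
    proof -
      have pos: "p N > 0" using N by linarith
      have "prob B \<le> prob {x \<in> space M. p N / 2 \<le> \<bar>S N x - expectation (S N)\<bar>}"
      proof (rule finite_measure_mono)
        show "B \<subseteq> {x \<in> space M. p N / 2 \<le> \<bar>S N x - expectation (S N)\<bar>}"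
        proof
          fix x assume "x \<in> B"
          then have "x \<in> space M" "S N x \<le> real k" by (auto simp: B_def)
          with N show "x \<in> {x \<in> space M. p N / 2 \<le> \<bar>S N x - expectation (S N)\<bar>}"
            unfolding ES by auto
        qed
      qed measurable
      also have "\<dots> \<le> variance (S N) / (p N / 2)\<^sup>2"
        using pos by (intro Chebyshev_inequality int2) auto
      also have "\<dots> \<le> C * p N / (p N / 2)\<^sup>2"
        by (intro divide_right_mono var) auto
      also have "\<dots> = 4 * C / p N"
        using pos by (simp add: field_simps power2_eq_square)
      finally show ?thesis .
    qed
    \<comment> \<open>\<open>B\<close> does not depend on N, while the bound tends to 0 as N
      grows.\<close>
    have "prob B \<le> 0"
    proof (rule tendsto_lowerbound)
      show "(\<lambda>N. 4 * C / p N) \<longlonglongrightarrow> 0"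
        by (rule real_tendsto_divide_at_top[OF tendsto_const p_top])
      show "\<forall>\<^sub>F N in sequentially. prob B \<le> 4 * C / p N"
        using p_top[unfolded filterlim_at_top, rule_format, of "2 * real k + 1"]
        by eventually_elim (rule bound)
    qed auto
    then have "emeasure M B = 0"
      by (simp add: emeasure_eq_measure measure_le_0_iff)
    then have "AE x in M. x \<notin> B"
      by (intro AE_not_in) auto
    then show ?thesis
      using AE_space by eventually_elim (auto simp: B_def not_le)
  qed
  have "AE x in M. \<forall>k. \<exists>N. S N x > real k"
    using null by (simp add: AE_all_countable)
  then show ?thesis
  proof eventually_elim
    case (elim x)
    show "\<exists>\<^sub>\<infinity>n. x \<in> A n"
    proof (rule ccontr)
      assume "\<not> (\<exists>\<^sub>\<infinity>n. x \<in> A n)"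
      then have fin: "finite {n. x \<in> A n}"
        by (simp add: INFM_iff_infinite)
      \<comment> \<open>A point in finitely many events has all its counts bounded by their number,
        so that number is the k to contradict.\<close>
      obtain N where N: "S N x > real (card {n. x \<in> A n})"
        using elim by blast
      have "S N x = real (card {n \<in> {..<N}. x \<in> A n})"
        by (simp add: S_def indicator_def sum.If_cases Int_def)
      also have "\<dots> \<le> real (card {n. x \<in> A n})"
        using fin by (intro of_nat_mono card_mono) auto
      finally show False using N by simp
    qed
  qed
qed

text \<open>The error in \<open>corr\<close> carries the probability of the later event. With n
  fixed, summing it over all earlier m costs at most \<open>suminf \<psi>\<close> times that
  probability, so the total error is linear in the mean. The diagonal m = n is included and is
  governed by \<open>\<psi> 0\<close>.\<close>

lemma (in prob_space) borel_cantelli_summable_correlations: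
  fixes A :: "nat \<Rightarrow> 'a set" and \<psi> :: "nat \<Rightarrow> real"
  assumes A: "\<And>n. A n \<in> events"
    and div: "\<not> summable (\<lambda>n. prob (A n))"
    and \<psi>: "summable \<psi>" "\<And>k. \<psi> k \<ge> 0"
    and corr: "\<And>m n. m \<le> n \<Longrightarrow>
                 prob (A m \<inter> A n) \<le> prob (A m) * prob (A n) + \<psi> (n - m) * prob (A n)"
  shows "AE x in M. \<exists>\<^sub>\<infinity>n. x \<in> A n"
proof (rule borel_cantelli_variance[OF A div])
  fix N :: nat
  define p where "p n = prob (A n)" for n
  \<comment> \<open>Truncated subtraction would give \<open>\<psi> 0\<close> for m > n, hence the
    explicit zero. With it, \<open>le\<close> holds for every m and n in either order; on the
    diagonal it only adds a nonnegative term.\<close>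
  define g where "g m n = (if m \<le> n then \<psi> (n - m) else 0)" for m n
  have g_nonneg: "g m n \<ge> 0" for m n
    using \<psi>(2) by (simp add: g_def)
  have le: "prob (A m \<inter> A n) \<le> p m * p n + g m n * p n + g n m * p m" for m n
  proof (cases "m \<le> n")
    case True
    have "g n m * p m \<ge> 0"
      using g_nonneg by (simp add: p_def)
    with corr[OF True] True show ?thesis by (simp add: g_def p_def)
  next
    case False
    then show ?thesis
      using corr[of n m] by (simp add: g_def p_def Int_commute mult.commute)
  qed
  \<comment> \<open>For fixed n the gaps n - m are distinct, so this is at most a partial sum of
    \<open>\<psi>\<close>.\<close>
  have g_sum: "(\<Sum>m<N. g m n) \<le> suminf \<psi>" for n
  proof -
    have "(\<Sum>m<N. g m n) = (\<Sum>m\<in>{..<N} \<inter> {..n}. \<psi> (n - m))"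
      by (simp add: g_def sum.If_cases atMost_def)
    also have "\<dots> \<le> (\<Sum>m\<in>{..n}. \<psi> (n - m))"
      using \<psi>(2) by (intro sum_mono2) auto
    also have "\<dots> = (\<Sum>k\<in>{..n}. \<psi> k)"
      by (rule sum.reindex_bij_witness[of _ "\<lambda>k. n - k" "\<lambda>k. n - k"]) auto
    also have "\<dots> \<le> suminf \<psi>"
      using \<psi> by (intro sum_le_suminf) auto
    finally show ?thesis .
  qed
  have gp: "(\<Sum>n<N. \<Sum>m<N. g m n * p n) \<le> suminf \<psi> * (\<Sum>n<N. p n)"
    unfolding sum_distrib_left sum_distrib_right[symmetric]
    by (intro sum_mono mult_right_mono g_sum) (simp add: p_def)
  have "(\<Sum>m<N. \<Sum>n<N. prob (A m \<inter> A n)) \<le>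
          (\<Sum>m<N. \<Sum>n<N. p m * p n + g m n * p n + g n m * p m)"
    by (intro sum_mono le)
  also have "\<dots> = (\<Sum>n<N. p n)\<^sup>2 + (\<Sum>m<N. \<Sum>n<N. g m n * p n) + (\<Sum>n<N. \<Sum>m<N. g m n * p n)"
    by (simp add: sum.distrib power2_eq_square sum_product)
  \<comment> \<open>The two orders of a pair contribute equally, whence the factor 2 in the
    constant.\<close>
  also have "(\<Sum>m<N. \<Sum>n<N. g m n * p n) = (\<Sum>n<N. \<Sum>m<N. g m n * p n)"
    by (rule sum.swap)
  finally show "(\<Sum>m<N. \<Sum>n<N. prob (A m \<inter> A n)) \<le>
      (\<Sum>n<N. prob (A n))\<^sup>2 + (2 * suminf \<psi>) * (\<Sum>n<N. prob (A n))"
    using gp by (simp add: p_def)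
qed

lemma measure_preserving_map_funpow:
  assumes "measure_preserving_map M T"
  shows "measure_preserving_map M (T ^^ n)"
proof (induction n)
  case 0
  show ?case
    by (auto simp: measure_preserving_map_def id_def Int_absorb2 sets.sets_into_space)
next
  case (Suc n)
  have T: "T \<in> measurable M M" and Tn: "(T ^^ n) \<in> measurable M M"
    using assms Suc by (auto simp: measure_preserving_map_def)
  have "(T ^^ Suc n) -` A \<inter> space M = (T ^^ n) -` (T -` A \<inter> space M) \<inter> space M" for A
    using measurable_space[OF Tn] by auto
  then have "emeasure M ((T ^^ Suc n) -` A \<inter> space M) = emeasure M A" if "A \<in> sets M" for A
    using assms Suc measurable_sets[OF T that] that unfolding measure_preserving_map_def by metis
  moreover have "T ^^ Suc n \<in> measurable M M"
    using measurable_comp[OF Tn T] by simp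
  ultimately show ?case
    unfolding measure_preserving_map_def by blast
qed

lemma measure_preserving_map_measure:
  assumes "measure_preserving_map M T" "A \<in> sets M"
  shows "measure M (T -` A \<inter> space M) = measure M A"
  using assms by (simp add: measure_preserving_map_def measure_def)

text \<open>For F of positive measure, multiply the bound on the quotient by \<open>prob F\<close>.
  A null F is outside the supremum, but its preimage is null by invariance. Finiteness matters
  because \<open>enn2real\<close> sends infinity to 0.\<close>

lemma (in prob_space) mixing_coeff_bound:
  assumes fin: "mixing_coeff M T \<C> n < \<infinity>" and E: "E \<in> \<C>" and F: "F \<in> \<C>" "F \<in> events"
    and T: "measure_preserving_map M T"
  shows "prob (E \<inter> ((T ^^ n) -` F \<inter> space M)) \<le>
           prob E * prob F + enn2real (mixing_coeff M T \<C> n) * prob F"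
proof (cases "prob F = 0")
  case True
  have Tn: "measure_preserving_map M (T ^^ n)"
    by (rule measure_preserving_map_funpow[OF T])
  have "prob (E \<inter> ((T ^^ n) -` F \<inter> space M)) \<le> prob ((T ^^ n) -` F \<inter> space M)"
    using Tn F by (intro finite_measure_mono) (auto simp: measure_preserving_map_def)
  also have "\<dots> = 0"
    using measure_preserving_map_measure[OF Tn F(2)] True by simp
  finally show ?thesis using True by simp
next
  case False
  then have pos: "prob F > 0" by (simp add: zero_less_measure_iff)
  let ?q = "prob (E \<inter> ((T ^^ n) -` F \<inter> space M))"
  have "ennreal \<bar>?q / prob F - prob E\<bar> \<le> mixing_coeff M T \<C> n"
    unfolding mixing_coeff_def using E F pos by (intro Sup_upper) blast
  then have "enn2real (ennreal \<bar>?q / prob F - prob E\<bar>) \<le> enn2real (mixing_coeff M T \<C> n)"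
    using fin by (intro enn2real_mono) auto
  then have "?q / prob F \<le> prob E + enn2real (mixing_coeff M T \<C> n)"
    by simp
  then show ?thesis
    using pos by (simp add: pos_divide_le_eq distrib_right)
qed

theorem corollary1:
  fixes M :: "'a measure" and T :: "'a \<Rightarrow> 'a" and \<C> :: "'a set set" and E :: "nat \<Rightarrow> 'a set"
  assumes "prob_space M"
    and "measure_preserving_map M T"
    and "\<C> \<subseteq> sets M"
    and "summable_mixing M T \<C>"
    and "\<And>n. n \<ge> 1 \<Longrightarrow> E n \<in> \<C>"
  shows "((\<Sum>n. emeasure M (E (Suc n))) < \<infinity> \<longrightarrow> emeasure M (hitting_limsup M T E) = 0) \<and>
         ((\<Sum>n. emeasure M (E (Suc n))) = \<infinity> \<longrightarrow> emeasure M (hitting_limsup M T E) = 1)"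
proof -
  interpret prob_space M by fact
  \<comment> \<open>The shift by one matches sequences indexed from 1 with sums over all naturals;
    \<open>E 0\<close> never enters.\<close>
  define A where "A n = (T ^^ Suc n) -` E (Suc n) \<inter> space M" for n
  have Tn: "measure_preserving_map M (T ^^ n)" for n
    by (rule measure_preserving_map_funpow) fact
  have EC: "E (Suc n) \<in> \<C>" and EM: "E (Suc n) \<in> events" for n
    using assms by auto
  have A: "A n \<in> events" for n
    unfolding A_def using Tn EM
    by (intro measurable_sets[of "T ^^ Suc n"]) (auto simp: measure_preserving_map_def simp del: funpow.simps)
  have pA: "prob (A n) = prob (E (Suc n))" for n
    unfolding A_def by (rule measure_preserving_map_measure[OF Tn EM])
  have eA: "emeasure M (E (Suc n)) = ennreal (prob (A n))" for n
    by (simp add: emeasure_eq_measure pA)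
  have sets_W: "hitting_limsup M T E \<in> events"
    using assms by (intro sets_hitting_limsup) (auto simp: measure_preserving_map_def)
  have W: "x \<in> hitting_limsup M T E \<longleftrightarrow> (\<exists>\<^sub>\<infinity>n. x \<in> A n)" if "x \<in> space M" for x
  proof -
    have "(\<exists>\<^sub>\<infinity>n. x \<in> A n) \<longleftrightarrow> (\<exists>\<^sub>\<infinity>n. (T ^^ Suc n) x \<in> E (Suc n))"
      using that by (simp add: A_def)
    \<comment> \<open>Shifting the index by one does not affect what happens infinitely
      often.\<close>
    also have "\<dots> \<longleftrightarrow> (\<exists>\<^sub>\<infinity>n. (T ^^ n) x \<in> E n)"
      unfolding frequently_def
      using eventually_sequentially_Suc[of "\<lambda>n. (T ^^ n) x \<notin> E n"]
      by (simp add: cofinite_eq_sequentially)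
    finally show ?thesis
      using that by (simp add: hitting_limsup_def)
  qed
  show ?thesis
  proof (intro conjI impI)
    assume "(\<Sum>n. emeasure M (E (Suc n))) < \<infinity>"
    then have "summable (\<lambda>n. prob (A n))"
      unfolding eA by (intro summable_suminf_not_top) auto
    then have "AE x in M. eventually (\<lambda>n. x \<in> space M - A n) sequentially"
      using A by (intro borel_cantelli_AE1) (auto simp: emeasure_eq_measure)
    then have "AE x in M. x \<notin> hitting_limsup M T E"
      using AE_space
      by eventually_elim
        (auto simp: W frequently_def cofinite_eq_sequentially elim: eventually_mono)
    then show "emeasure M (hitting_limsup M T E) = 0"
      using sets_W by (simp add: AE_iff_measurable[OF _ refl] AE_iff_null_sets null_setsD1)
  next
    assume inf: "(\<Sum>n. emeasure M (E (Suc n))) = \<infinity>"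
    have div: "\<not> summable (\<lambda>n. prob (A n))"
    proof
      assume "summable (\<lambda>n. prob (A n))"
      then have "(\<Sum>n. ennreal (prob (A n))) = ennreal (\<Sum>n. prob (A n))"
        by (intro suminf_ennreal2) auto
      with inf show False by (simp add: eA)
    qed
    let ?\<phi> = "mixing_coeff M T \<C>"
    have sum_fin: "(\<Sum>n. ?\<phi> (Suc n)) \<noteq> \<infinity>"
      using assms(4) by (simp add: summable_mixing_def)
    have fin: "?\<phi> (Suc n) < \<infinity>" for n
      using assms(4) unfolding summable_mixing_def by (rule ennreal_suminf_lessD)
    \<comment> \<open>The value 1 at 0 covers the diagonal terms; \<open>?\<phi> 0\<close> itself may be infinite.\<close>
    define \<psi> where "\<psi> k = (if k = 0 then 1 else enn2real (?\<phi> k))" for k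
    have "(\<Sum>n. ennreal (\<psi> (Suc n))) \<noteq> top"
      using sum_fin fin by (simp add: \<psi>_def)
    then have "summable (\<lambda>n. \<psi> (Suc n))"
      by (intro summable_suminf_not_top) (auto simp: \<psi>_def)
    then have sum_\<psi>: "summable \<psi>"
      by (simp add: summable_Suc_iff)
    have corr: "prob (A m \<inter> A n) \<le> prob (A m) * prob (A n) + \<psi> (n - m) * prob (A n)"
      if "m \<le> n" for m n
    proof (cases "m = n")
      case True
      then show ?thesis by (simp add: \<psi>_def)
    next
      case False
      then have "m < n" using that by simp
      then obtain d where n: "n = m + Suc d"
        using less_imp_Suc_add by auto
      \<comment> \<open>Pulling out the common preimage under \<open>T ^^ Suc m\<close> leaves
        \<open>?B\<close>, with gap \<open>Suc d\<close> equal to n - m. Invariance removes that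
        preimage, and mixing applies at a gap of at least 1.\<close>
      let ?B = "E (Suc m) \<inter> ((T ^^ Suc d) -` E (Suc n) \<inter> space M)"
      have B: "?B \<in> events"
        using Tn[of "Suc d"] EM[of m] EM[of n] unfolding measure_preserving_map_def
        by (intro sets.Int[OF EM] measurable_sets[of "T ^^ Suc d"]) blast+
      have split: "T ^^ Suc n = (T ^^ Suc d) \<circ> (T ^^ Suc m)"
        unfolding n funpow_add[symmetric] by (simp add: add.commute)
      \<comment> \<open>Orbits stay in the space, so the intersection with \<open>space M\<close>
        inside \<open>?B\<close> loses no points.\<close>
      have "(T ^^ Suc m) x \<in> space M" if "x \<in> space M" for x
        using Tn[of "Suc m"] measurable_space[OF _ that, of "T ^^ Suc m" M]
        unfolding measure_preserving_map_def by blast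
      then have "A m \<inter> A n = (T ^^ Suc m) -` ?B \<inter> space M"
        unfolding A_def split by auto
      then have "prob (A m \<inter> A n) = prob ?B"
        by (simp only: measure_preserving_map_measure[OF Tn B])
      also have "\<dots> \<le> prob (E (Suc m)) * prob (E (Suc n)) +
                        enn2real (?\<phi> (Suc d)) * prob (E (Suc n))"
        by (intro mixing_coeff_bound fin EC EM assms)
      finally show ?thesis
        by (simp add: pA n \<psi>_def)
    qed
    have "AE x in M. \<exists>\<^sub>\<infinity>n. x \<in> A n"
      by (rule borel_cantelli_summable_correlations[OF A div sum_\<psi> _ corr]) (simp add: \<psi>_def)
    then have "AE x in M. x \<in> hitting_limsup M T E"
      using AE_space by eventually_elim (simp add: W)
    then show "emeasure M (hitting_limsup M T E) = 1"
      using sets_W by (intro emeasure_eq_1_AE)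
  qed
qed

end
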